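(* Let $n\ge 1$ and $m\ge 2$ be two integers and $d=\gcd(m,n)$. Then $$[\mathbb{Z}_{2n}^-]\circledcirc[\mathbb{Z}_m\oplus\mathbb{Z}_2^c]=\begin{cases}\{[\mathbb{1}],[\mathbb{Z}_{2d}^-]\}&\text{if } m/d \text{ is even},\\ \{[\mathbb{1}],[\mathbb{Z}_d]\}&\text{otherwise}.\end{cases}$$
   Context: $[K]$ is the conjugacy class of a subgroup $K$ in $\mathrm{O}(3)$, and the clips operation is $[H_1]\circledcirc[H_2]=\{[H_1\cap gH_2g^{-1}]:g\in\mathrm{O}(3)\}$. $(e_1,e_2,e_3)$ is the canonical basis of $\mathbb{R}^3$, $\mathbf{r}(n,\theta)$ is the rotation by angle $\theta$ about the axis directed by $n\neq0$. $\mathbb{1}=\{\mathrm{Id}\}$; $\mathbb{Z}_2^c=\{\pm\mathrm{Id}\}$; $H\oplus\mathbb{Z}_2^c=H\cup(-H)$ for $H\subset\mathrm{SO}(3)$; $\mathbb{Z}_k=\{\mathbf{r}(e_3,2j\pi/k):0\le j\le k-1\}$, with $\mathbb{Z}_1=\mathbb{1}$; $\mathbb{Z}_{2k}^-=\mathbb{Z}_k\cup(-\mathbf{r}(e_3,\pi/k))\mathbb{Z}_k$ for $k\ge1$. *)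

theory Defs
  imports "HOL-Analysis.Analysis"
begin

definition O3 :: "(real^3^3) set" where
  "O3 = {A. orthogonal_matrix A}"

definition e3 :: "real^3" where
  "e3 = axis 3 1"

text \<open>Rodrigues' formula for the right-handed rotation by angle \<open>\<theta>\<close> about the axis directed by
  \<open>n \<noteq> 0\<close>, as a matrix in the canonical basis; \<open>n\<close> need not be a unit vector. The value at
  \<open>n = 0\<close> has no meaning.\<close>

definition rot :: "real^3 \<Rightarrow> real \<Rightarrow> real^3^3" where
  "rot n \<theta> = (let u = n /\<^sub>R norm n in
     matrix (\<lambda>v. cos \<theta> *\<^sub>R v + sin \<theta> *\<^sub>R cross3 u v + ((1 - cos \<theta>) * (u \<bullet> v)) *\<^sub>R u))"

definition trivial_grp :: "(real^3^3) set" where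
  "trivial_grp = {mat 1}"

definition cyc :: "nat \<Rightarrow> (real^3^3) set" where
  "cyc k = {rot e3 (2 * real j * pi / real k) | j. j < k}"

text \<open>\<open>cyc_minus k\<close> is the group of order \<open>2k\<close> written \<open>\<int>\<^sub>2\<^sub>k\<^sup>-\<close>: the index in the mathematical
  notation is twice the argument.\<close>

definition cyc_minus :: "nat \<Rightarrow> (real^3^3) set" where
  "cyc_minus k = cyc k \<union> (\<lambda>A. (- rot e3 (pi / real k)) ** A) ` cyc k"

text \<open>\<open>H \<oplus> \<int>\<^sub>2\<^sup>c = H \<union> (-H)\<close>, for \<open>H\<close> a subgroup of \<open>SO(3)\<close>.\<close>

definition oplus_Z2c :: "(real^3^3) set \<Rightarrow> (real^3^3) set" where
  "oplus_Z2c H = H \<union> uminus ` H"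

definition conjugate :: "real^3^3 \<Rightarrow> (real^3^3) set \<Rightarrow> (real^3^3) set" where
  "conjugate g K = (\<lambda>A. g ** A ** matrix_inv g) ` K"

definition conj_class :: "(real^3^3) set \<Rightarrow> (real^3^3) set set" where
  "conj_class K = {conjugate g K | g. g \<in> O3}"

text \<open>The clips operation acts on conjugacy classes. It is defined through all representatives of
  the two classes; \<open>clips_conj_class\<close> below shows that any single choice gives the same result.\<close>

definition clips :: "(real^3^3) set set \<Rightarrow> (real^3^3) set set \<Rightarrow> (real^3^3) set set set"
    (infixl "\<circledcirc>" 70) where
  "C1 \<circledcirc> C2 = {conj_class (H1 \<inter> conjugate g H2) | H1 H2 g.
      conj_class H1 = C1 \<and> conj_class H2 = C2 \<and> g \<in> O3}"

lemma matrix_inv_O3: "g \<in> O3 \<Longrightarrow> matrix_inv g = transpose g"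
proof -
  assume "g \<in> O3"
  then have *: "transpose g ** g = mat 1" "g ** transpose g = mat 1"
    by (simp_all add: O3_def orthogonal_matrix_def)
  have "g ** matrix_inv g = mat 1 \<and> matrix_inv g ** g = mat 1"
    unfolding matrix_inv_def by (rule someI[of _ "transpose g"]) (simp add: *)
  then show ?thesis
    by (metis * matrix_mul_assoc matrix_mul_lid matrix_mul_rid)
qed

lemma O3_mult: "g \<in> O3 \<Longrightarrow> h \<in> O3 \<Longrightarrow> g ** h \<in> O3"
  by (simp add: O3_def orthogonal_matrix_mul)

lemma O3_transpose: "g \<in> O3 \<Longrightarrow> transpose g \<in> O3"
  by (simp add: O3_def orthogonal_matrix_def)

lemma conjugate_one: "conjugate (mat 1) K = K"
proof -
  have "mat 1 \<in> O3" by (simp add: O3_def orthogonal_matrix_id)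
  then show ?thesis by (simp add: conjugate_def matrix_inv_O3 transpose_mat)
qed

lemma conjugate_conjugate:
  "g \<in> O3 \<Longrightarrow> h \<in> O3 \<Longrightarrow> conjugate g (conjugate h K) = conjugate (g ** h) K"
  by (simp add: conjugate_def matrix_inv_O3 O3_mult image_image matrix_transpose_mul matrix_mul_assoc)

lemma conjugate_transpose:
  assumes "g \<in> O3"
  shows "conjugate (transpose g) (conjugate g K) = K"
    and "conjugate g (conjugate (transpose g) K) = K"
  using assms O3_transpose[OF assms]
  by (simp_all add: conjugate_conjugate conjugate_one O3_def orthogonal_matrix_def)

lemma conjugate_Int:
  assumes "g \<in> O3"
  shows "conjugate g (A \<inter> B) = conjugate g A \<inter> conjugate g B"
proof -
  have "X = Y" if "g ** X ** matrix_inv g = g ** Y ** matrix_inv g" for X Y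
  proof -
    have "conjugate g {X} = conjugate g {Y}" using that by (simp add: conjugate_def)
    then have "{X} = {Y}" by (metis assms conjugate_transpose(1))
    then show ?thesis by simp
  qed
  then have "inj (\<lambda>A. g ** A ** matrix_inv g)" by (auto intro: injI)
  then show ?thesis by (simp add: conjugate_def image_Int)
qed

lemma conj_class_conjugate:
  assumes g: "g \<in> O3"
  shows "conj_class (conjugate g K) = conj_class K"
proof -
  have *: "conj_class (conjugate h L) \<subseteq> conj_class L" if "h \<in> O3" for h L
    using that by (auto simp: conj_class_def conjugate_conjugate intro: O3_mult)
  show ?thesis
    using *[OF g, of K] *[OF O3_transpose[OF g], of "conjugate g K"]
    by (simp add: conjugate_transpose(1)[OF g])
qed

lemma conj_class_eqD:
  assumes "conj_class H = conj_class K"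
  obtains g where "g \<in> O3" "H = conjugate g K"
proof -
  have "mat 1 \<in> O3" by (simp add: O3_def orthogonal_matrix_id)
  then have "H \<in> conj_class H" unfolding conj_class_def using conjugate_one by blast
  then show ?thesis using assms that by (auto simp: conj_class_def)
qed

lemma clips_conj_class:
  "conj_class H1 \<circledcirc> conj_class H2 = {conj_class (H1 \<inter> conjugate g H2) | g. g \<in> O3}"
proof (intro subset_antisym subsetI)
  fix c assume "c \<in> conj_class H1 \<circledcirc> conj_class H2"
  then obtain K1 K2 g where c: "c = conj_class (K1 \<inter> conjugate g K2)" and g: "g \<in> O3"
    and K: "conj_class K1 = conj_class H1" "conj_class K2 = conj_class H2"
    by (auto simp: clips_def)
  obtain a where a: "a \<in> O3" "K1 = conjugate a H1" using K(1) conj_class_eqD by blast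
  obtain b where b: "b \<in> O3" "K2 = conjugate b H2" using K(2) conj_class_eqD by blast
  define h where "h = transpose a ** (g ** b)"
  have h: "h \<in> O3" using a b g by (simp add: h_def O3_mult O3_transpose)
  have "conjugate (transpose a) (K1 \<inter> conjugate g K2) = H1 \<inter> conjugate h H2"
    using a b g by (simp add: conjugate_Int O3_transpose O3_mult conjugate_transpose
        conjugate_conjugate[of "transpose a"] conjugate_conjugate[of g] h_def)
  then have "c = conj_class (H1 \<inter> conjugate h H2)"
    using c conj_class_conjugate[OF O3_transpose[OF a(1)]] by metis
  then show "c \<in> {conj_class (H1 \<inter> conjugate g H2) | g. g \<in> O3}" using h by blast
qed (auto simp: clips_def)

end

theory Submission
  imports Defs
begin

text \<open>
  All elements of the two groups are rotations about the axis \<open>e3\<close> or negatives of such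
  rotations, and conjugating by \<open>g\<close> moves the axis of the second group to \<open>g e3\<close>
  (\<open>rot_conj\<close>). Hence the intersection depends only on whether the axes coincide.

  If \<open>g e3\<close> is not \<open>e3\<close> or \<open>- e3\<close>, then the intersection is trivial, because a nontrivial rotation
  determines its axis and \<open>cyc_minus n\<close> does not contain \<open>-1\<close>
  (\<open>Int_conjugate_other_axis\<close>).

  If \<open>g e3\<close> is \<open>e3\<close> or \<open>- e3\<close>, then \<open>g\<close> normalises the second group
  (\<open>conjugate_oplus_same_axis\<close>), so that the intersection is the one of the groups themselves.
  Let \<open>turn x\<close> be the rotation by \<open>x\<close> full turns. It lies in both groups when \<open>n * x\<close> and
  \<open>m * x\<close> are integers, that is when \<open>d * x\<close> is an integer by Bezout: this is the group \<open>cyc d\<close>.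
  Its negative lies in both when \<open>n * x\<close> is half an odd number and \<open>m * x\<close> is an integer.
  This is impossible if \<open>m div d\<close> is odd; otherwise it says that \<open>d * x\<close> is half an odd
  number, which describes the improper half of \<open>cyc_minus d\<close> (\<open>gcd_mult_half_odd_iff\<close>,
  \<open>cyc_minus_Int_oplus\<close>).

  Both kinds of \<open>g\<close> exist, so both classes occur.
\<close>


section \<open>Integer and half-odd multiples of a real number\<close>

text \<open>The numbers \<open>k\<close> with \<open>k * x \<in> \<int>\<close> form an ideal of \<open>\<int>\<close>, and \<open>gcd m n\<close> generates
  the ideal generated by \<open>m\<close> and \<open>n\<close>.\<close>

lemma gcd_mult_Ints_iff:
  fixes x :: real
  shows "real (gcd m n) * x \<in> \<int> \<longleftrightarrow> real m * x \<in> \<int> \<and> real n * x \<in> \<int>"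
proof
  assume "real (gcd m n) * x \<in> \<int>"
  then have "real k * x \<in> \<int>" if k: "gcd m n dvd k" for k
  proof -
    from k obtain l where "k = gcd m n * l" by (rule dvdE)
    then have "real k * x = real l * (real (gcd m n) * x)" by simp
    with \<open>real (gcd m n) * x \<in> \<int>\<close> show ?thesis by (simp only: Ints_mult Ints_of_nat)
  qed
  then show "real m * x \<in> \<int> \<and> real n * x \<in> \<int>" by simp
next
  assume *: "real m * x \<in> \<int> \<and> real n * x \<in> \<int>"
  obtain u v :: int where "u * int m + v * int n = int (gcd m n)"
    using bezout_int[of "int m" "int n"] by auto
  then have "of_int (int (gcd m n)) = (of_int (u * int m + v * int n) :: real)" by simp
  then have "real (gcd m n) = of_int u * real m + of_int v * real n" by simp
  then have "real (gcd m n) * x = of_int u * (real m * x) + of_int v * (real n * x)"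
    by (simp add: algebra_simps)
  then show "real (gcd m n) * x \<in> \<int>" using * by simp
qed

lemma half_notin_Ints: "(1/2::real) \<notin> \<int>"
proof
  assume "(1/2::real) \<in> \<int>"
  then obtain j :: int where "(1/2::real) = of_int j" by (auto elim: Ints_cases)
  then have "of_int (2 * j) = (of_int 1 :: real)" by simp
  then have "2 * j = 1" by (simp only: of_int_eq_iff)
  then show False by presburger
qed

text \<open>\<open>y - 1/2 \<in> \<int>\<close> says that \<open>y\<close> is half an odd number.\<close>

lemma half_odd_mult_iff:
  fixes y :: real
  assumes "y - 1/2 \<in> \<int>"
  shows "real k * y \<in> \<int> \<longleftrightarrow> even k" and "real k * y - 1/2 \<in> \<int> \<longleftrightarrow> odd k"
proof -
  obtain i where "y - 1/2 = of_int i" using assms by (rule Ints_cases)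
  then have i: "y = of_int i + 1/2" by simp
  have ev: "real k * y \<in> \<int>" if "even k"
    using that by (auto elim!: evenE simp: i algebra_simps)
  have od: "real k * y - 1/2 \<in> \<int>" if k: "odd k"
  proof -
    obtain b where "k = 2 * b + 1" using k by (elim oddE)
    then have "real k * y - 1/2 = of_int (i * (2 * int b + 1) + int b)"
      by (simp add: i field_simps)
    then show ?thesis by (simp only: Ints_of_int)
  qed
  have "\<not> (real k * y \<in> \<int> \<and> real k * y - 1/2 \<in> \<int>)"
    using half_notin_Ints Ints_diff[of "real k * y" "real k * y - 1/2"] by auto
  then show "real k * y \<in> \<int> \<longleftrightarrow> even k" and "real k * y - 1/2 \<in> \<int> \<longleftrightarrow> odd k"
    using ev od by blast+
qed

text \<open>Only the oddness of \<open>2 * d * x\<close> is at stake: \<open>2 * m * x\<close> and \<open>2 * n * x\<close> are integers, so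
  by Bezout \<open>2 * d * x\<close> is one, and if it were even then \<open>n * x\<close> would be an integer. Once \<open>d * x\<close>
  is half an odd number, \<open>m * x = (m div d) * (d * x)\<close> is an integer exactly when \<open>m div d\<close> is
  even, and then \<open>n div d\<close>, being coprime to it, is odd.\<close>

lemma gcd_mult_half_odd_iff:
  fixes x :: real
  assumes n: "n > 0" and d: "d = gcd m n"
  shows "real m * x \<in> \<int> \<and> real n * x - 1/2 \<in> \<int> \<longleftrightarrow> even (m div d) \<and> real d * x - 1/2 \<in> \<int>"
proof -
  have quot: "real k * x = real (k div d) * (real d * x)" if "d dvd k" for k
    using that by (simp flip: mult.assoc of_nat_mult)
  have md: "real m * x = real (m div d) * (real d * x)"
    and nd: "real n * x = real (n div d) * (real d * x)"
    by (rule quot; simp add: d)+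
  have cop: "coprime (m div d) (n div d)" using n d by (simp add: div_gcd_coprime)
  show ?thesis
  proof
    assume *: "real m * x \<in> \<int> \<and> real n * x - 1/2 \<in> \<int>"
    have n2: "real (2 * n) * x \<in> \<int>"
      using half_odd_mult_iff(1)[of "real n * x" 2] * by (simp add: mult.assoc)
    have m2: "real (2 * m) * x \<in> \<int>"
      using * by (simp add: mult.assoc)
    have "real (2 * d) * x \<in> \<int>"
      using gcd_mult_Ints_iff[of "2 * m" "2 * n" x] n2 m2 d by (simp add: gcd_mult_distrib_nat)
    then obtain t where t: "2 * (real d * x) = of_int t" by (auto simp: mult.assoc elim: Ints_cases)
    have "odd t"
    proof
      assume "even t"
      then have "real d * x \<in> \<int>" using t by (auto elim!: evenE)
      then have "real n * x \<in> \<int>" unfolding nd by (rule Ints_mult[OF Ints_of_nat])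
      then have "(real n * x) - (real n * x - 1/2) \<in> \<int>" using * by (blast intro: Ints_diff)
      then show False using half_notin_Ints by simp
    qed
    then obtain b where "t = 2 * b + 1" by (elim oddE)
    then have "real d * x - 1/2 = of_int b" using t by simp
    then have half: "real d * x - 1/2 \<in> \<int>" by simp
    then show "even (m div d) \<and> real d * x - 1/2 \<in> \<int>"
      using half_odd_mult_iff(1)[OF half, of "m div d"] * unfolding md by blast
  next
    assume *: "even (m div d) \<and> real d * x - 1/2 \<in> \<int>"
    then have "odd (n div d)" using cop coprime_common_divisor[of "m div d" "n div d" 2] by auto
    then show "real m * x \<in> \<int> \<and> real n * x - 1/2 \<in> \<int>"
      unfolding md nd using * half_odd_mult_iff by blast
  qed
qed

section \<open>Rotations\<close>

text \<open>Measuring angles in full turns makes \<open>\<int>\<close> the period, so that membership in the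
  groups becomes a statement about multiples of \<open>x\<close> in \<open>\<int>\<close>.\<close>

definition turn :: "real \<Rightarrow> real^3^3" where
  "turn x = rot e3 (2 * pi * x)"

lemma rot_mult_vec:
  "rot n \<theta> *v v = (let u = n /\<^sub>R norm n in
     cos \<theta> *\<^sub>R v + sin \<theta> *\<^sub>R cross3 u v + ((1 - cos \<theta>) * (u \<bullet> v)) *\<^sub>R u)"
proof -
  have "linear (\<lambda>v. cos \<theta> *\<^sub>R v + sin \<theta> *\<^sub>R cross3 u v + ((1 - cos \<theta>) * (u \<bullet> v)) *\<^sub>R u)" for u
    by (rule linearI)
      (simp_all add: cross_add_right cross_mult_right inner_right_distrib algebra_simps)
  then show ?thesis
    unfolding rot_def Let_def by (simp only: matrix_works linear_matrix_vector_mul_eq)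
qed

lemma rot_minus_axis: "rot (- n) \<theta> = rot n (- \<theta>)"
  by (simp add: matrix_eq rot_mult_vec Let_def)

lemma norm_orthogonal_matrix_mult_vec:
  fixes g :: "real^'n^'n"
  shows "orthogonal_matrix g \<Longrightarrow> norm (g *v v) = norm v"
  using orthogonal_transformation_matrix[of "(*v) g"] by (simp add: orthogonal_transformation)

text \<open>Rodrigues' formula involves only scalar products, norms and one cross product; \<open>g\<close>
  preserves the former and multiplies the latter by its determinant, which reverses the angle
  when \<open>g\<close> is improper.\<close>

lemma rot_conj:
  assumes g: "g \<in> O3"
  shows "g ** rot n \<theta> ** matrix_inv g = rot (g *v n) (det g * \<theta>)"
proof -
  have og: "orthogonal_matrix g" using g by (simp add: O3_def)
  have gt: "orthogonal_transformation ((*v) g)"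
    using og by (simp add: orthogonal_transformation_matrix)
  have nrm: "norm (g *v v) = norm v" for v
    using og by (rule norm_orthogonal_matrix_mult_vec)
  have inn: "(g *v v) \<bullet> (g *v w) = v \<bullet> w" for v w
    using gt by (simp add: orthogonal_transformation_def)
  have d: "det g = 1 \<or> det g = - 1" using og by (rule det_orthogonal_matrix)
  have cr: "g *v cross3 v w = det g *\<^sub>R cross3 (g *v v) (g *v w)" for v w
    using cross_orthogonal_matrix[OF og, of v w] d by auto
  have "g ** rot n \<theta> = rot (g *v n) (det g * \<theta>) ** g"
    using d by (auto simp: matrix_eq rot_mult_vec Let_def nrm inn cr matrix_vector_mul_assoc[symmetric]
      matrix_vector_right_distrib matrix_vector_mult_scaleR cross_mult_left)
  then show ?thesis
    using g by (simp add: matrix_inv_O3 matrix_mul_assoc[symmetric] O3_def orthogonal_matrix_def)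
qed

lemma norm_e3: "norm e3 = 1"
  by (simp add: e3_def)

lemma rot_e3_mult_vec:
  "rot e3 \<theta> *v v = vector [cos \<theta> * v$1 - sin \<theta> * v$2, sin \<theta> * v$1 + cos \<theta> * v$2, v$3]"
  unfolding rot_mult_vec norm_e3 Let_def
  by (simp add: vec_eq_iff forall_3 cross3_def inner_vec_def sum_3 e3_def axis_def algebra_simps)

lemma rot_e3_entry: "rot e3 \<theta> $ i $ j = (rot e3 \<theta> *v axis j 1) $ i"
  by (simp add: matrix_vector_mul_component inner_axis row_def)

lemma det_rot_e3: "det (rot e3 \<theta>) = 1"
proof -
  have "det (rot e3 \<theta>) = (cos \<theta>)\<^sup>2 + (sin \<theta>)\<^sup>2"
    by (simp add: det_3 rot_e3_entry rot_e3_mult_vec axis_def power2_eq_square)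
  then show ?thesis by simp
qed

lemma rot_e3_add: "rot e3 a ** rot e3 b = rot e3 (a + b)"
  by (simp add: matrix_eq rot_e3_mult_vec matrix_vector_mul_assoc[symmetric] vec_eq_iff forall_3
    cos_add sin_add algebra_simps)

lemma rot_e3_eq_iff: "rot e3 a = rot e3 b \<longleftrightarrow> sin a = sin b \<and> cos a = cos b"
proof
  assume "rot e3 a = rot e3 b"
  then have "rot e3 a *v axis 1 1 = rot e3 b *v axis 1 1" by simp
  then show "sin a = sin b \<and> cos a = cos b"
    by (simp add: rot_e3_mult_vec vec_eq_iff forall_3 axis_def)
qed (simp add: matrix_eq rot_e3_mult_vec)

lemma turn_eq_iff: "turn x = turn y \<longleftrightarrow> x - y \<in> \<int>"
proof -
  have "turn x = turn y \<longleftrightarrow> (\<exists>k::int. 2 * pi * x = 2 * pi * y + 2 * pi * of_int k)"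
    unfolding turn_def rot_e3_eq_iff by (rule sin_cos_eq_iff)
  also have "\<dots> \<longleftrightarrow> (\<exists>k::int. 2 * pi * (x - y) = 2 * pi * of_int k)"
    by (simp add: algebra_simps)
  also have "\<dots> \<longleftrightarrow> x - y \<in> \<int>"
    by (auto simp: Ints_def)
  finally show ?thesis .
qed

text \<open>In the horizontal plane \<open>turn x - 1\<close> has determinant \<open>(1 - c)\<^sup>2 + s\<^sup>2\<close>, with \<open>c\<close> and
  \<open>s\<close> the cosine and sine of the angle; this is positive unless the rotation is trivial.\<close>

lemma turn_fixed_vec:
  assumes "turn x *v v = v" and "x \<notin> \<int>"
  shows "v = (v $ 3) *\<^sub>R e3"
proof -
  define c s where "c = cos (2 * pi * x)" and "s = sin (2 * pi * x)"
  have 1: "c * v$1 - s * v$2 = v$1" "s * v$1 + c * v$2 = v$2"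
    using assms(1) by (simp_all add: turn_def rot_e3_mult_vec vec_eq_iff forall_3 c_def s_def)
  have "c \<noteq> 1" using assms(2) by (auto simp: c_def cos_one_2pi_int)
  then have "(1 - c)\<^sup>2 + s\<^sup>2 > 0"
    by (simp add: add_pos_nonneg)
  \<comment> \<open>Cramer's rule for the two equations that say that \<open>v\<close> is fixed\<close>
  moreover have "((1 - c)\<^sup>2 + s\<^sup>2) * v$1
      = (c - 1) * (c * v$1 - s * v$2 - v$1) + s * (s * v$1 + c * v$2 - v$2)"
    by (simp add: power2_eq_square algebra_simps)
  moreover have "((1 - c)\<^sup>2 + s\<^sup>2) * v$2
      = (c - 1) * (s * v$1 + c * v$2 - v$2) - s * (c * v$1 - s * v$2 - v$1)"
    by (simp add: power2_eq_square algebra_simps)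
  ultimately have "v$1 = 0" "v$2 = 0" using 1 by auto
  then show ?thesis by (simp add: vec_eq_iff forall_3 e3_def axis_def)
qed

lemma uminus_matrix_mult: "(- A) ** B = - (A ** B)" "A ** (- B) = - (A ** B)"
  for A B :: "real^3^3"
  by (simp_all add: matrix_matrix_mult_def vec_eq_iff sum_negf)

lemma det_uminus_3: "det (- A) = - det A" for A :: "real^3^3"
  by (simp add: det_3)

text \<open>In odd dimension \<open>-1\<close> reverses orientation, so the proper and the improper elements of
  a group can be treated separately.\<close>

lemma uminus_turn_neq_turn: "- turn x \<noteq> turn y"
proof
  assume "- turn x = turn y"
  then have "det (- turn x) = det (turn y)" by simp
  then show False by (simp add: turn_def det_rot_e3 det_uminus_3)
qed

lemma turn_add: "turn x ** turn y = turn (x + y)"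
  by (simp add: turn_def rot_e3_add algebra_simps)

lemma turn_eq_one_iff: "turn x = mat 1 \<longleftrightarrow> x \<in> \<int>"
proof -
  have "turn 0 = mat 1"
    by (simp add: turn_def matrix_eq rot_e3_mult_vec vec_eq_iff forall_3)
  then show ?thesis using turn_eq_iff[of x 0] by simp
qed

lemma turn_e3: "turn x *v e3 = e3"
  unfolding turn_def rot_e3_mult_vec by (simp add: e3_def axis_def vec_eq_iff forall_3)

section \<open>Membership in the groups\<close>

lemma cyc_eq:
  assumes k: "k > 0"
  shows "cyc k = {turn x | x. real k * x \<in> \<int>}"
proof (intro subset_antisym subsetI)
  fix A assume "A \<in> cyc k"
  then obtain j where "A = rot e3 (2 * real j * pi / real k)" by (auto simp: cyc_def)
  then have "A = turn (real j / real k)" by (simp add: turn_def mult_ac)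
  moreover have "real k * (real j / real k) \<in> \<int>" using k by simp
  ultimately show "A \<in> {turn x | x. real k * x \<in> \<int>}" by blast
next
  fix A assume "A \<in> {turn x | x. real k * x \<in> \<int>}"
  then obtain x i where A: "A = turn x" and i: "real k * x = of_int i" by (auto elim!: Ints_cases)
  define j where "j = nat (i mod int k)"
  have j: "j < k" "int j = i mod int k" using k by (auto simp: j_def nat_less_iff)
  have "i = int k * (i div int k) + int j" by (simp add: j(2))
  then have "of_int i = (of_int (int k * (i div int k) + int j) :: real)" by (rule arg_cong)
  then have "of_int i = real k * of_int (i div int k) + real j" by simp
  then have "x - real j / real k = of_int (i div int k)"
    using i k by (simp add: field_simps)
  then have "A = turn (real j / real k)" by (simp add: A turn_eq_iff)
  then have "A = rot e3 (2 * real j * pi / real k)" by (simp add: turn_def mult_ac)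
  then show "A \<in> cyc k" using j(1) by (auto simp: cyc_def)
qed

lemma turn_in_cyc_iff: "k > 0 \<Longrightarrow> turn x \<in> cyc k \<longleftrightarrow> real k * x \<in> \<int>"
proof -
  assume k: "k > 0"
  have "real k * x \<in> \<int>" if "turn x = turn y" "real k * y \<in> \<int>" for y
  proof -
    have "real k * (x - y) \<in> \<int>" using that(1) turn_eq_iff by auto
    then have "real k * (x - y) + real k * y \<in> \<int>" using that(2) by (rule Ints_add)
    then show ?thesis by (simp add: algebra_simps)
  qed
  then show ?thesis using k by (auto simp: cyc_eq)
qed

lemma uminus_turn_notin_cyc: "k > 0 \<Longrightarrow> - turn x \<notin> cyc k"
  using uminus_turn_neq_turn by (auto simp: cyc_eq)

text \<open>The generator \<open>- rot e3 (pi / k)\<close> turns by \<open>1 / (2 * k)\<close>, which shifts \<open>k * x\<close> by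
  one half.\<close>

lemma cyc_minus_eq:
  assumes k: "k > 0"
  shows "cyc_minus k = cyc k \<union> {- turn x | x. real k * x - 1/2 \<in> \<int>}"
proof -
  have r: "rot e3 (pi / real k) = turn (1 / (2 * real k))" by (simp add: turn_def)
  have m: "- rot e3 (pi / real k) ** turn x = - turn (x + 1 / (2 * real k))" for x
    by (simp add: r turn_add add.commute uminus_matrix_mult)
  have "(\<lambda>A. (- rot e3 (pi / real k)) ** A) ` cyc k = {- turn x | x. real k * x - 1/2 \<in> \<int>}"
    (is "?L = ?R")
  proof (intro subset_antisym subsetI)
    fix A assume "A \<in> ?L"
    then obtain x where x: "A = - turn (x + 1 / (2 * real k))" "real k * x \<in> \<int>"
      using k by (auto simp: cyc_eq m)
    moreover have "real k * (x + 1 / (2 * real k)) - 1/2 = real k * x" using k by (simp add: field_simps)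
    ultimately show "A \<in> ?R" by (intro CollectI exI[of _ "x + 1 / (2 * real k)"]) simp
  next
    fix A assume "A \<in> ?R"
    then obtain x where x: "A = - turn x" "real k * x - 1/2 \<in> \<int>" by auto
    have "real k * (x - 1 / (2 * real k)) = real k * x - 1/2" using k by (simp add: field_simps)
    then have "turn (x - 1 / (2 * real k)) \<in> cyc k" using x k by (simp add: turn_in_cyc_iff)
    moreover have "A = - rot e3 (pi / real k) ** turn (x - 1 / (2 * real k))" by (simp add: m x)
    ultimately show "A \<in> ?L" by blast
  qed
  then show ?thesis by (simp add: cyc_minus_def)
qed

lemma turn_in_cyc_minus_iff: "k > 0 \<Longrightarrow> turn x \<in> cyc_minus k \<longleftrightarrow> real k * x \<in> \<int>"
  using uminus_turn_neq_turn[of _ x] by (auto simp: cyc_minus_eq turn_in_cyc_iff dest: sym)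

lemma uminus_turn_in_cyc_minus_iff:
  assumes k: "k > 0"
  shows "- turn x \<in> cyc_minus k \<longleftrightarrow> real k * x - 1/2 \<in> \<int>"
proof -
  have "real k * x - 1/2 \<in> \<int>" if "turn x = turn y" "real k * y - 1/2 \<in> \<int>" for y
  proof -
    have "real k * (x - y) \<in> \<int>" using that(1) turn_eq_iff by auto
    then have "real k * (x - y) + (real k * y - 1/2) \<in> \<int>" using that(2) by (rule Ints_add)
    then show ?thesis by (simp add: algebra_simps)
  qed
  then show ?thesis using k by (auto simp: cyc_minus_eq uminus_turn_notin_cyc)
qed

lemma turn_in_oplus_iff:
  assumes k: "k > 0"
  shows "turn x \<in> oplus_Z2c (cyc k) \<longleftrightarrow> real k * x \<in> \<int>"
proof -
  have "turn x \<notin> uminus ` cyc k" using uminus_turn_notin_cyc[OF k] by (metis imageE minus_minus)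
  then show ?thesis using k by (simp add: oplus_Z2c_def turn_in_cyc_iff)
qed

lemma uminus_turn_in_oplus_iff: "k > 0 \<Longrightarrow> - turn x \<in> oplus_Z2c (cyc k) \<longleftrightarrow> real k * x \<in> \<int>"
  by (auto simp: oplus_Z2c_def uminus_turn_notin_cyc image_iff turn_in_cyc_iff)

lemma cyc_minus_cases:
  assumes "A \<in> cyc_minus k" "k > 0"
  obtains x where "A = turn x" | x where "A = - turn x"
  using assms by (auto simp: cyc_minus_eq cyc_eq)

section \<open>Intersections with the conjugates\<close>

lemma cyc_minus_Int_oplus:
  assumes n: "n > 0" and m: "m > 0" and d: "d = gcd m n"
  shows "cyc_minus n \<inter> oplus_Z2c (cyc m) = (if even (m div d) then cyc_minus d else cyc d)"
    (is "?L = ?R")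
proof -
  have dpos: "d > 0" using n d by simp
  have t: "turn x \<in> ?L \<longleftrightarrow> turn x \<in> ?R" for x
    using gcd_mult_Ints_iff[of m n x] n m d dpos
    by (auto simp: turn_in_cyc_minus_iff turn_in_cyc_iff turn_in_oplus_iff)
  have u: "- turn x \<in> ?L \<longleftrightarrow> - turn x \<in> ?R" for x
    using gcd_mult_half_odd_iff[OF n d, of x] n m dpos
    by (auto simp: uminus_turn_in_cyc_minus_iff uminus_turn_notin_cyc uminus_turn_in_oplus_iff)
  have "?R \<subseteq> cyc_minus d" by (auto simp: cyc_minus_def)
  then show ?thesis using t u n dpos
    by (intro set_eqI iffI) (blast elim: cyc_minus_cases[of _ n], blast elim: cyc_minus_cases[of _ d])
qed

lemma conj_turn:
  assumes "g \<in> O3"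
  shows "g ** turn x ** matrix_inv g = rot (g *v e3) (det g * (2 * pi * x))"
  using rot_conj[OF assms] by (simp add: turn_def)

text \<open>Such a \<open>g\<close> sends each rotation about \<open>e3\<close> to itself or to its inverse. It is enough to
  prove one inclusion, for \<open>g\<close> and for its transpose.\<close>

lemma conjugate_oplus_same_axis:
  assumes g: "g \<in> O3" and k: "k > 0" and ax: "g *v e3 = e3 \<or> g *v e3 = - e3"
  shows "conjugate g (oplus_Z2c (cyc k)) = oplus_Z2c (cyc k)"
proof -
  have *: "conjugate h (oplus_Z2c (cyc k)) \<subseteq> oplus_Z2c (cyc k)"
    if h: "h \<in> O3" and hax: "h *v e3 = e3 \<or> h *v e3 = - e3" for h
  proof -
    have c: "h ** A ** matrix_inv h \<in> cyc k" if A: "A \<in> cyc k" for A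
    proof -
      obtain x where x: "A = turn x" "real k * x \<in> \<int>" using A k by (auto simp: cyc_eq)
      have "det h = 1 \<or> det h = - 1" using h det_orthogonal_matrix by (auto simp: O3_def)
      then have "h ** A ** matrix_inv h = turn x \<or> h ** A ** matrix_inv h = turn (- x)"
        unfolding x conj_turn[OF h] using hax by (auto simp: rot_minus_axis turn_def)
      then show ?thesis using x k by (auto simp: turn_in_cyc_iff)
    qed
    have "h ** (- A) ** matrix_inv h = - (h ** A ** matrix_inv h)" for A
      by (simp add: uminus_matrix_mult)
    then show ?thesis using c by (auto simp: conjugate_def oplus_Z2c_def)
  qed
  have "(transpose g ** g) *v e3 = e3"
    using g by (simp add: O3_def orthogonal_matrix_def)
  moreover have "transpose g *v (- e3) = - (transpose g *v e3)"
    by (rule linear_neg[OF matrix_vector_mul_linear])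
  ultimately have "transpose g *v e3 = e3 \<or> transpose g *v e3 = - e3"
    using ax by (metis matrix_vector_mul_assoc minus_minus)
  then have "conjugate (transpose g) (oplus_Z2c (cyc k)) \<subseteq> oplus_Z2c (cyc k)"
    using * g O3_transpose by blast
  then have "conjugate g (conjugate (transpose g) (oplus_Z2c (cyc k))) \<subseteq> conjugate g (oplus_Z2c (cyc k))"
    unfolding conjugate_def by (rule image_mono)
  then show ?thesis using *[OF g ax] conjugate_transpose(2)[OF g] by auto
qed

text \<open>An element of both groups is, up to a common sign, a rotation about \<open>e3\<close> and about
  \<open>g e3\<close>. A nontrivial rotation has only one axis, so the element is \<open>1\<close> or \<open>-1\<close>; and \<open>-1\<close> is
  not in \<open>cyc_minus n\<close>, because \<open>0\<close> is not half an odd number.\<close>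

lemma Int_conjugate_other_axis:
  assumes g: "g \<in> O3" and n: "n > 0" and k: "k > 0" and ax: "g *v e3 \<noteq> e3" "g *v e3 \<noteq> - e3"
  shows "cyc_minus n \<inter> conjugate g (oplus_Z2c (cyc k)) = trivial_grp"
proof -
  have det_conj: "det (g ** A ** matrix_inv g) = det A" for A
  proof -
    have "det (g ** A ** matrix_inv g) = det g * det (matrix_inv g) * det A"
      by (simp add: det_mul)
    also have "det g * det (matrix_inv g) = 1"
      using g det_orthogonal_matrix by (fastforce simp: O3_def matrix_inv_O3)
    finally show ?thesis by simp
  qed
  have same: "turn x = mat 1" if "turn x = g ** turn y ** matrix_inv g" for x y
  proof (rule ccontr)
    assume "turn x \<noteq> mat 1"
    moreover have "turn x *v (g *v e3) = g *v (turn y *v ((matrix_inv g ** g) *v e3))"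
      by (simp add: that matrix_vector_mul_assoc matrix_mul_assoc)
    then have "turn x *v (g *v e3) = g *v e3"
      using g by (simp add: matrix_inv_O3 O3_def orthogonal_matrix_def turn_e3)
    ultimately obtain c where c: "g *v e3 = c *\<^sub>R e3"
      using turn_fixed_vec turn_eq_one_iff by blast
    have "norm (g *v e3) = norm e3"
      using g by (simp add: O3_def norm_orthogonal_matrix_mult_vec)
    then have "c = 1 \<or> c = - 1" using norm_e3 abs_eq_iff[of c 1] by (simp add: c)
    then show False using ax c by auto
  qed
  have opp: "- turn x \<noteq> g ** turn y ** matrix_inv g" for x y
  proof
    assume "- turn x = g ** turn y ** matrix_inv g"
    then have "det (- turn x) = det (turn y)" using det_conj by metis
    then show False by (simp add: det_uminus_3 turn_def det_rot_e3)
  qed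
  show ?thesis
  proof (intro subset_antisym subsetI)
    fix A assume A: "A \<in> cyc_minus n \<inter> conjugate g (oplus_Z2c (cyc k))"
    then obtain B where B: "B \<in> oplus_Z2c (cyc k)" "A = g ** B ** matrix_inv g"
      by (auto simp: conjugate_def)
    from B(1) obtain y where "B = turn y \<or> B = - turn y"
      using k by (auto simp: oplus_Z2c_def cyc_eq)
    then have y: "A = g ** turn y ** matrix_inv g \<or> A = - (g ** turn y ** matrix_inv g)"
      by (auto simp: B(2) uminus_matrix_mult)
    have "A \<in> cyc_minus n" using A by simp
    then show "A \<in> trivial_grp" using n
    proof (cases rule: cyc_minus_cases)
      case (1 x)
      then have "turn x = g ** turn y ** matrix_inv g"
        using y opp[of x y] by (metis minus_minus)
      then show ?thesis using same 1 by (auto simp: trivial_grp_def)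
    next
      case (2 x)
      then have "turn x = g ** turn y ** matrix_inv g"
        using y opp[of x y] by (metis minus_minus)
      then have "turn x = turn 0" using same turn_eq_one_iff[of 0] by auto
      moreover have "- turn x \<in> cyc_minus n" using A 2 by simp
      ultimately have "(- 1 / 2 :: real) \<in> \<int>"
        using uminus_turn_in_cyc_minus_iff[OF n, of 0] by simp
      then have "(1/2 :: real) \<in> \<int>" using Ints_minus by fastforce
      then show ?thesis using half_notin_Ints by simp
    qed
  next
    fix A assume "A \<in> trivial_grp"
    then have A: "A = turn 0" using turn_eq_one_iff[of 0] by (simp add: trivial_grp_def)
    moreover have "g ** turn 0 ** matrix_inv g = turn 0"
      using g turn_eq_one_iff[of 0] by (simp add: matrix_inv_O3 O3_def orthogonal_matrix_def)
    ultimately show "A \<in> cyc_minus n \<inter> conjugate g (oplus_Z2c (cyc k))"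
      using turn_in_cyc_minus_iff[OF n, of 0] turn_in_oplus_iff[OF k, of 0]
      by (auto simp: conjugate_def image_iff) (metis)
  qed
qed

theorem lemma4p3:
  fixes n m d :: nat
  assumes "n \<ge> 1" and "m \<ge> 2" and "d = gcd m n"
  shows "conj_class (cyc_minus n) \<circledcirc> conj_class (oplus_Z2c (cyc m)) =
    (if even (m div d) then {conj_class trivial_grp, conj_class (cyc_minus d)}
     else {conj_class trivial_grp, conj_class (cyc d)})"
proof -
  let ?I = "\<lambda>g. cyc_minus n \<inter> conjugate g (oplus_Z2c (cyc m))"
  let ?K = "if even (m div d) then cyc_minus d else cyc d"
  have pos: "n > 0" "m > 0" using assms by auto
  have same: "?I g = ?K" if "g \<in> O3" "g *v e3 = e3 \<or> g *v e3 = - e3" for g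
    using conjugate_oplus_same_axis[OF that(1) pos(2) that(2)] cyc_minus_Int_oplus[OF pos assms(3)]
    by simp
  have other: "?I g = trivial_grp" if "g \<in> O3" "\<not> (g *v e3 = e3 \<or> g *v e3 = - e3)" for g
    using Int_conjugate_other_axis that pos by blast
  have one: "mat 1 \<in> O3" by (simp add: O3_def orthogonal_matrix_id)
  \<comment> \<open>an \<open>h\<close> that moves the axis, so that the trivial class does occur\<close>
  obtain h :: "real^3^3" where h: "orthogonal_matrix h" "h *v axis 3 1 = axis 1 1"
    using orthogonal_matrix_exists_basis[of "axis 1 1 :: real^3" 3] by auto
  have hax: "h *v e3 \<noteq> e3" "h *v e3 \<noteq> - e3"
    using h(2) by (auto simp: e3_def axis_def vec_eq_iff forall_3)
  have "{conj_class (?I g) | g. g \<in> O3} = {conj_class trivial_grp, conj_class ?K}"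
  proof (intro subset_antisym subsetI)
    fix c assume "c \<in> {conj_class (?I g) | g. g \<in> O3}"
    then obtain g where g: "g \<in> O3" and c: "c = conj_class (?I g)" by blast
    from same[OF g] other[OF g] have "?I g = ?K \<or> ?I g = trivial_grp" by argo
    then show "c \<in> {conj_class trivial_grp, conj_class ?K}"
      unfolding c by (elim disjE) (simp_all only: insert_iff simp_thms)
  next
    fix c assume "c \<in> {conj_class trivial_grp, conj_class ?K}"
    moreover have "?I (mat 1) = ?K" using same[OF one] by simp
    moreover have "?I h = trivial_grp" using other[of h] h(1) hax by (simp add: O3_def)
    moreover have "h \<in> O3" using h(1) by (simp add: O3_def)
    ultimately have "c = conj_class (?I h) \<or> c = conj_class (?I (mat 1))"
      by (simp only: insert_iff empty_iff simp_thms)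
    then show "c \<in> {conj_class (?I g) | g. g \<in> O3}"
      using one \<open>h \<in> O3\<close> by blast
  qed
  then show ?thesis by (auto simp: clips_conj_class)
qed

end
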